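(* Let $A_0,A_1,A_2$ be three $n\times n$ real symmetric matrices. Then the following two statements are equivalent. (i) Both of the following hold: (i.1) $\max\{x^TA_0x,\,x^TA_1x,\,x^TA_2x\}\ge0$ for all $x\in\mathbb{R}^n$; (i.2) there exists a permutation $\{j_0,j_1,j_2\}$ of $\{0,1,2\}$ such that the system $$x^TA_{j_0}x<0,\qquad x^TA_{j_1}x=0,\qquad x^TA_{j_2}x=0$$ has no solution $x\in\mathbb{R}^n$ and Property $\mathcal{IR}$ fails for $A_{j_0},A_{j_1},A_{j_2}$. (ii) There exist $\mu_k^0\ge0$ ($k=0,1,2$) with $\sum_{k=0}^2\mu_k^0=1$ such that $\mu_0^0A_0+\mu_1^0A_1+\mu_2^0A_2\succeq0$.
   Context: $M\succeq0$ means that $M$ is positive semidefinite; $I_n$ is the $n\times n$ identity matrix. Property $\mathcal{IR}$. For real symmetric $n\times n$ matrices $B_0,B_1,B_2$ (in this order), Property $\mathcal{IR}$ holds for $B_0,B_1,B_2$ if there exist three positive real numbers $\breve\mu_1,\breve\mu_2,\breve\mu_3$ and two vectors $\breve x_1,\breve x_2\in\mathbb{R}^n$ such that (IR.1) $\breve Z:=B_0+\breve\mu_1B_1+\breve\mu_2B_2+\breve\mu_3I_n\succeq0$ and the null space of $\breve Z$ equals the linear span of $\breve x_1,\breve x_2$; (IR.2) $\breve x_1^TB_1\breve x_1=\breve x_2^TB_1\breve x_2=0$ and $\breve x_1^TB_1\breve x_2\neq0$; (IR.3) $\breve x_1^TB_2\breve x_1<0<\breve x_2^TB_2\breve x_2$.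 *)

theory Defs
  imports "HOL-Analysis.Analysis" "HOL-Combinatorics.Permutations"
begin

definition symmetric_matrix :: "real ^ 'n ^ 'n \<Rightarrow> bool" where
  "symmetric_matrix M \<longleftrightarrow> transpose M = M"

definition quad_form :: "real ^ 'n ^ 'n \<Rightarrow> real ^ 'n \<Rightarrow> real" where
  "quad_form M x = x \<bullet> (M *v x)"

definition pos_semidef :: "real ^ 'n ^ 'n \<Rightarrow> bool" where
  "pos_semidef M \<longleftrightarrow> symmetric_matrix M \<and> (\<forall>x. 0 \<le> quad_form M x)"

definition null_space :: "real ^ 'n ^ 'n \<Rightarrow> (real ^ 'n) set" where
  "null_space M = {x. M *v x = 0}"

definition property_IR :: "real ^ 'n ^ 'n \<Rightarrow> real ^ 'n ^ 'n \<Rightarrow> real ^ 'n ^ 'n \<Rightarrow> bool" where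
  "property_IR B0 B1 B2 \<longleftrightarrow>
     (\<exists>(\<mu>1::real) (\<mu>2::real) (\<mu>3::real) x1 x2.
        0 < \<mu>1 \<and> 0 < \<mu>2 \<and> 0 < \<mu>3 \<and>
        (let Z = B0 + \<mu>1 *\<^sub>R B1 + \<mu>2 *\<^sub>R B2 + \<mu>3 *\<^sub>R mat 1
         in pos_semidef Z \<and> null_space Z = span {x1, x2}) \<and>
        quad_form B1 x1 = 0 \<and> quad_form B1 x2 = 0 \<and> x1 \<bullet> (B1 *v x2) \<noteq> 0 \<and>
        quad_form B2 x1 < 0 \<and> 0 < quad_form B2 x2)"

end

theory Submission
  imports Defs
begin

text \<open>
  Suppose (i) holds for \<open>B0, B1, B2\<close> and (ii) fails. Separating the convex hull \<open>C\<close> of the joint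
  range of the three forms on the unit sphere from the negative octant produces a strictly negative
  point of \<open>C\<close>. With (i.1), perturbation upgrades the unsolvability assumption in (i.2) to: there is
  no \<open>x\<close> with \<open>B0\<close> negative and \<open>B1, B2\<close> nonpositive at \<open>x\<close>. On the other hand, the minimum of the first
  coordinate over the part of \<open>C\<close> with nonpositive last two coordinates is a negative number
  \<open>- \<mu>3\<close>, and the strictly negative point is a Slater point, so Lagrange multipliers give a positive
  semidefinite \<open>Z = B0 + \<mu>1 B1 + \<mu>2 B2 + \<mu>3 I\<close> whose null space \<open>N\<close> contains all the vectors that
  make up the minimiser. Rotating pairs of these vectors yields elements of \<open>N\<close> on which one form
  vanishes and the other has a prescribed weak sign; this forces \<open>\<mu>1, \<mu>2 > 0\<close> and supplies the two
  vectors of Property IR. Any third independent vector in \<open>N\<close> would, by the intermediate value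
  theorem along a conic, give a common zero of \<open>B1\<close> and \<open>B2\<close> in \<open>N\<close>, at which \<open>B0\<close> is negative. Hence
  Property IR holds, a contradiction.
\<close>

section \<open>Symmetric matrices and their quadratic forms\<close>

lemma symmetric_matrix_dot:
  "symmetric_matrix M \<Longrightarrow> x \<bullet> (M *v y) = y \<bullet> (M *v x)"
  unfolding symmetric_matrix_def
  by (metis dot_lmul_matrix inner_commute vector_transpose_matrix)

lemma symmetric_matrix_add:
  "symmetric_matrix M \<Longrightarrow> symmetric_matrix N \<Longrightarrow> symmetric_matrix (M + N)"
  unfolding symmetric_matrix_def by (simp add: transpose_def vec_eq_iff)

lemma symmetric_matrix_scaleR: "symmetric_matrix M \<Longrightarrow> symmetric_matrix (c *\<^sub>R M)"
  unfolding symmetric_matrix_def by (simp add: transpose_def vec_eq_iff)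

lemma symmetric_matrix_mat: "symmetric_matrix (mat c)"
  unfolding symmetric_matrix_def by simp

lemmas symmetric_matrix_intros =
  symmetric_matrix_add symmetric_matrix_scaleR symmetric_matrix_mat

lemma quad_form_matrix_add: "quad_form (M + N) x = quad_form M x + quad_form N x"
  by (simp add: quad_form_def matrix_vector_mult_add_rdistrib inner_add_right)

lemma quad_form_matrix_scaleR: "quad_form (c *\<^sub>R M) x = c * quad_form M x"
  by (simp add: quad_form_def flip: scaleR_matrix_vector_assoc)

lemma quad_form_mat_1: "quad_form (mat 1) x = x \<bullet> x"
  by (simp add: quad_form_def)

lemmas quad_form_matrix_simps =
  quad_form_matrix_add quad_form_matrix_scaleR quad_form_mat_1

lemma quad_form_scaleR: "quad_form M (c *\<^sub>R x) = c\<^sup>2 * quad_form M x"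
  by (simp add: quad_form_def matrix_vector_mult_scaleR power2_eq_square)

lemma quad_form_minus [simp]: "quad_form M (- x) = quad_form M x"
  using quad_form_scaleR[of M "-1" x] by simp

lemma quad_form_zero [simp]: "quad_form M 0 = 0"
  by (simp add: quad_form_def)

lemma quad_form_add:
  "symmetric_matrix M \<Longrightarrow>
   quad_form M (x + y) = quad_form M x + quad_form M y + 2 * (x \<bullet> (M *v y))"
  by (simp add: quad_form_def matrix_vector_right_distrib inner_add_left inner_add_right
      symmetric_matrix_dot[of M y x])

lemma quad_form_comb2:
  "symmetric_matrix M \<Longrightarrow>
   quad_form M (a *\<^sub>R x + b *\<^sub>R y) =
     a\<^sup>2 * quad_form M x + b\<^sup>2 * quad_form M y + 2 * a * b * (x \<bullet> (M *v y))"
  by (simp add: quad_form_add quad_form_scaleR matrix_vector_mult_scaleR)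

lemma quad_form_comb3:
  "symmetric_matrix M \<Longrightarrow>
   quad_form M (a *\<^sub>R x + b *\<^sub>R y + c *\<^sub>R z) =
     a\<^sup>2 * quad_form M x + b\<^sup>2 * quad_form M y + c\<^sup>2 * quad_form M z
     + 2 * a * b * (x \<bullet> (M *v y)) + 2 * a * c * (x \<bullet> (M *v z)) + 2 * b * c * (y \<bullet> (M *v z))"
  by (simp add: quad_form_add quad_form_scaleR matrix_vector_mult_scaleR inner_add_left
      algebra_simps)

lemma continuous_on_quad_form [continuous_intros]:
  "continuous_on S f \<Longrightarrow> continuous_on S (\<lambda>t. quad_form M (f t))"
  unfolding quad_form_def
  by (intro continuous_on_inner
      continuous_on_compose2[OF matrix_vector_mult_linear_continuous_on[of UNIV M]]) auto

lemma subspace_null_space: "subspace (null_space M)"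
  unfolding null_space_def subspace_def
  by (auto simp: matrix_vector_right_distrib matrix_vector_mult_scaleR)

lemma quad_form_null_space: "x \<in> null_space M \<Longrightarrow> quad_form M x = 0"
  by (simp add: null_space_def quad_form_def)

text \<open>With \<open>d = M *v x\<close>, a step from \<open>x\<close> of length factor
  \<open>s\<close> along \<open>- d\<close> changes the form by
  \<open>s\<^sup>2 * quad_form M d - 2 * s * (d \<bullet> d)\<close>, which would be negative for
  small \<open>s > 0\<close> unless \<open>d = 0\<close>.\<close>

lemma pos_semidef_null_space:
  assumes psd: "pos_semidef M" and x: "quad_form M x = 0"
  shows "x \<in> null_space M"
proof -
  have sym: "symmetric_matrix M" and nonneg: "\<And>y. 0 \<le> quad_form M y"
    using psd by (auto simp: pos_semidef_def)
  define d where "d = M *v x"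
  have "d = 0"
  proof (rule ccontr)
    assume "d \<noteq> 0"
    have all: "2 * (d \<bullet> d) \<le> s * quad_form M d" if "0 < s" for s
    proof -
      have "0 \<le> quad_form M (1 *\<^sub>R x + (- s) *\<^sub>R d)"
        by (rule nonneg)
      also have "\<dots> = s\<^sup>2 * quad_form M d - 2 * s * (d \<bullet> d)"
        using symmetric_matrix_dot[OF sym, of x d]
        by (subst quad_form_comb2[OF sym]) (simp add: x d_def)
      also have "\<dots> = s * (s * quad_form M d - 2 * (d \<bullet> d))"
        by (simp add: algebra_simps power2_eq_square)
      finally show ?thesis
        using that by (simp add: zero_le_mult_iff)
    qed
    have "0 < d \<bullet> d" using \<open>d \<noteq> 0\<close> by simp
    \<comment> \<open>The step is short enough that \<open>s * quad_form M d\<close> stays below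
      \<open>d \<bullet> d\<close>; the 1 in the denominator covers
      \<open>quad_form M d = 0\<close>.\<close>
    have "2 * (d \<bullet> d) \<le> (d \<bullet> d) / (1 + quad_form M d) * quad_form M d"
      using \<open>0 < d \<bullet> d\<close> nonneg[of d] by (intro all) (simp add: add_pos_nonneg)
    also have "\<dots> \<le> d \<bullet> d"
      using \<open>0 < d \<bullet> d\<close> nonneg[of d] by (simp add: field_simps)
    finally show False using \<open>0 < d \<bullet> d\<close> by simp
  qed
  then show ?thesis by (simp add: null_space_def d_def)
qed

section \<open>Rotations, isotropic vectors and common zeros\<close>

lemma exists_isotropic_rotation:
  assumes "symmetric_matrix F" "0 < quad_form F x" "quad_form F y < 0"
  obtains c s :: real where "c\<^sup>2 + s\<^sup>2 = 1" "quad_form F (c *\<^sub>R x + s *\<^sub>R y) = 0"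
proof -
  have "\<exists>t\<ge>0. t \<le> pi / 2 \<and> quad_form F (cos t *\<^sub>R x + sin t *\<^sub>R y) = 0"
    using assms by (intro IVT2') (auto intro!: continuous_intros)
  then show thesis using that by (metis sin_cos_squared_add2)
qed

text \<open>A rotation of the pair \<open>x\<close>, \<open>y\<close> leaves the matrix
  \<open>x x^T + y y^T\<close> unchanged, and the sum of the two values is the trace of
  \<open>M\<close> against it.\<close>

lemma quad_form_rotation:
  assumes sym: "symmetric_matrix M" and "c\<^sup>2 + s\<^sup>2 = (1::real)"
  shows "quad_form M (c *\<^sub>R x + s *\<^sub>R y) + quad_form M ((- s) *\<^sub>R x + c *\<^sub>R y)
       = quad_form M x + quad_form M y"
proof -
  have "quad_form M (c *\<^sub>R x + s *\<^sub>R y) + quad_form M ((- s) *\<^sub>R x + c *\<^sub>R y)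
      = (c\<^sup>2 + s\<^sup>2) * quad_form M x + (c\<^sup>2 + s\<^sup>2) * quad_form M y"
    unfolding quad_form_comb2[OF sym] by (simp add: algebra_simps)
  then show ?thesis using assms(2) by simp
qed

text \<open>This is the rank-one decomposition of Sturm and Zhang. Rotating a vector where
  \<open>F\<close> is positive against one where it is negative makes \<open>F\<close> vanish at one
  of them and keeps all sums. Once \<open>F\<close> vanishes at every vector, the sum of
  \<open>G\<close> being nonpositive yields a nonzero vector where \<open>G\<close> is
  nonpositive.\<close>

lemma exists_isotropic_nonpos:
  assumes "finite I" "subspace N" "symmetric_matrix F" "symmetric_matrix G"
    and "\<And>i. i \<in> I \<Longrightarrow> z i \<in> N" and "0 < (\<Sum>i\<in>I. z i \<bullet> z i)"
    and "(\<Sum>i\<in>I. quad_form F (z i)) = 0" and "(\<Sum>i\<in>I. quad_form G (z i)) \<le> 0"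
  obtains x where "x \<in> N" "x \<noteq> 0" "quad_form F x = 0" "quad_form G x \<le> 0"
proof -
  have "\<exists>x\<in>N. x \<noteq> 0 \<and> quad_form F x = 0 \<and> quad_form G x \<le> 0"
    using assms(5-8)
  proof (induction "card {i\<in>I. quad_form F (z i) \<noteq> 0}" arbitrary: z rule: less_induct)
    case less
    show ?case
    proof (cases "\<forall>i\<in>I. quad_form F (z i) = 0")
      case True
      show ?thesis
      proof (rule ccontr)
        assume "\<not> ?thesis"
        then have pos: "0 < quad_form G (z i)" if "i \<in> I" "z i \<noteq> 0" for i
          using True less.prems(1) that by (meson not_le)
        have nonneg: "0 \<le> quad_form G (z i)" if "i \<in> I" for i
          using pos[OF that] by (cases "z i = 0") auto
        have "\<exists>i\<in>I. z i \<noteq> 0"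
        proof (rule ccontr)
          assume "\<not> (\<exists>i\<in>I. z i \<noteq> 0)"
          then have "(\<Sum>i\<in>I. z i \<bullet> z i) = 0" by simp
          then show False using less.prems(2) by simp
        qed
        then obtain i where "i \<in> I" "z i \<noteq> 0" by blast
        then have "0 < (\<Sum>i\<in>I. quad_form G (z i))"
          using pos nonneg by (intro sum_pos2[OF assms(1)]) auto
        then show False using less.prems(4) by simp
      qed
    next
      case False
      have "\<exists>i\<in>I. 0 < quad_form F (z i)"
      proof (rule ccontr)
        assume "\<not> (\<exists>i\<in>I. 0 < quad_form F (z i))"
        then have "\<forall>i\<in>I. quad_form F (z i) = 0"
          using less.prems(3) assms(1) sum_nonneg_eq_0_iff[of I "\<lambda>i. - quad_form F (z i)"]
          by (auto simp: not_less sum_negf)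
        then show False using False by blast
      qed
      then obtain i where i: "i \<in> I" "0 < quad_form F (z i)" by blast
      have "\<exists>j\<in>I. quad_form F (z j) < 0"
      proof (rule ccontr)
        assume "\<not> (\<exists>j\<in>I. quad_form F (z j) < 0)"
        then have "\<forall>i\<in>I. quad_form F (z i) = 0"
          using less.prems(3) assms(1) sum_nonneg_eq_0_iff[of I "\<lambda>i. quad_form F (z i)"]
          by (auto simp: not_less)
        then show False using False by blast
      qed
      then obtain j where j: "j \<in> I" "quad_form F (z j) < 0" by blast
      have "i \<noteq> j" using i j by auto
      obtain c s :: real where cs: "c\<^sup>2 + s\<^sup>2 = 1" "quad_form F (c *\<^sub>R z i + s *\<^sub>R z j) = 0"
        using exists_isotropic_rotation[OF assms(3) i(2) j(2)] .
      define w where "w = z(i := c *\<^sub>R z i + s *\<^sub>R z j, j := (- s) *\<^sub>R z i + c *\<^sub>R z j)"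
      have sums: "(\<Sum>k\<in>I. quad_form M (w k)) = (\<Sum>k\<in>I. quad_form M (z k))"
        if "symmetric_matrix M" for M
      proof -
        have split: "(\<Sum>k\<in>I. f k) = f i + f j + (\<Sum>k\<in>I - {i} - {j}. f k)" for f :: "_ \<Rightarrow> real"
          using assms(1) i(1) j(1) \<open>i \<noteq> j\<close>
          by (simp add: sum.remove[of I i] sum.remove[of "I - {i}" j])
        have "(\<Sum>k\<in>I - {i} - {j}. quad_form M (w k)) = (\<Sum>k\<in>I - {i} - {j}. quad_form M (z k))"
          by (intro sum.cong) (auto simp: w_def)
        moreover have "quad_form M (w i) + quad_form M (w j) = quad_form M (z i) + quad_form M (z j)"
          using quad_form_rotation[OF that cs(1), of "z i" "z j"] \<open>i \<noteq> j\<close> by (simp add: w_def)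
        ultimately show ?thesis
          unfolding split[of "\<lambda>k. quad_form M (w k)"] split[of "\<lambda>k. quad_form M (z k)"] by simp
      qed
      \<comment> \<open>Index \<open>i\<close> leaves the set of nonzero values. The new value at
        \<open>j\<close> may be anything, because \<open>j\<close> was in the set already; so the
        cardinality drops.\<close>
      have "quad_form F (w i) = 0" using cs(2) \<open>i \<noteq> j\<close> by (simp add: w_def)
      moreover have "quad_form F (w k) = quad_form F (z k)" if "k \<noteq> i" "k \<noteq> j" for k
        using that by (simp add: w_def)
      ultimately have "{k\<in>I. quad_form F (w k) \<noteq> 0} \<subseteq> {k\<in>I. quad_form F (z k) \<noteq> 0} - {i}"
        using j(2) by fastforce
      moreover have "i \<in> {k\<in>I. quad_form F (z k) \<noteq> 0}" using i by simp
      ultimately have "{k\<in>I. quad_form F (w k) \<noteq> 0} \<subset> {k\<in>I. quad_form F (z k) \<noteq> 0}"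
        by blast
      then have "card {k\<in>I. quad_form F (w k) \<noteq> 0} < card {k\<in>I. quad_form F (z k) \<noteq> 0}"
        using assms(1) by (intro psubset_card_mono) auto
      moreover have "w k \<in> N" if "k \<in> I" for k
        unfolding w_def using less.prems(1)[OF that] less.prems(1)[OF i(1)] less.prems(1)[OF j(1)] assms(2)
        by (auto simp: subspace_add subspace_diff subspace_scale)
      moreover have "0 < (\<Sum>k\<in>I. w k \<bullet> w k)"
        using sums[OF symmetric_matrix_mat[of 1]] less.prems(2) by (simp add: quad_form_mat_1)
      ultimately show ?thesis
        using sums[OF assms(3)] sums[OF assms(4)] less.prems(3,4)
        by (intro less.hyps[of w]) simp_all
    qed
  qed
  then show thesis using that by blast
qed

text \<open>Within the plane of \<open>p\<close> and \<open>q\<close> the null cone of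
  \<open>F\<close> is just two lines, so a path on it from \<open>p\<close> to \<open>q\<close> must
  pass through 0. A third dimension allows a path on the cone that avoids 0, and \<open>G\<close>
  changes sign along it.\<close>

lemma exists_common_zero_dim3:
  assumes sym: "symmetric_matrix F" "symmetric_matrix G"
    and N: "subspace N" "p \<in> N" "q \<in> N" "r \<in> N"
    and F: "quad_form F p = 0" "quad_form F q = 0" "p \<bullet> (F *v q) \<noteq> 0"
    and G: "quad_form G p < 0" "0 < quad_form G q"
    and r: "r \<notin> span {p, q}"
  obtains x where "x \<in> N" "x \<noteq> 0" "quad_form F x = 0" "quad_form G x = 0"
proof -
  define d where "d = p \<bullet> (F *v q)"
  \<comment> \<open>The component of \<open>r\<close> that is \<open>F\<close>-orthogonal to \<open>p\<close> and \<open>q\<close>.\<close>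
  define r' where "r' = r - ((r \<bullet> (F *v q) / d) *\<^sub>R p + (r \<bullet> (F *v p) / d) *\<^sub>R q)"
  have d: "d \<noteq> 0" "q \<bullet> (F *v p) = d"
    using F(3) symmetric_matrix_dot[OF sym(1), of p q] by (auto simp: d_def)
  have r'_N: "r' \<in> N"
    unfolding r'_def using N by (intro subspace_diff subspace_add subspace_scale)
  have comb: "a *\<^sub>R p + b *\<^sub>R q \<in> span {p, q}" for a b
    by (intro span_add span_scale span_base) auto
  have r'_span: "r' \<notin> span {p, q}"
    using r comb unfolding r'_def by (metis span_add diff_add_cancel)
  have orth: "p \<bullet> (F *v r') = 0" "q \<bullet> (F *v r') = 0"
    using d F(1,2) symmetric_matrix_dot[OF sym(1), of p r] symmetric_matrix_dot[OF sym(1), of q r]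
    by (auto simp: r'_def matrix_vector_mult_diff_distrib matrix_vector_right_distrib
        matrix_vector_mult_scaleR inner_diff_right inner_add_right quad_form_def d_def[symmetric])
  have indep: "a *\<^sub>R p + b *\<^sub>R q + c *\<^sub>R r' \<noteq> 0" if "c \<noteq> 0" for a b c
  proof
    assume "a *\<^sub>R p + b *\<^sub>R q + c *\<^sub>R r' = 0"
    then have "c *\<^sub>R r' = (- a) *\<^sub>R p + (- b) *\<^sub>R q"
      by (simp add: eq_neg_iff_add_eq_0 add.commute algebra_simps)
    then have "c *\<^sub>R r' \<in> span {p, q}" using comb by metis
    then show False using r'_span that span_scale[of "c *\<^sub>R r'" "{p, q}" "inverse c"] by simp
  qed
  have F_comb: "quad_form F (a *\<^sub>R p + b *\<^sub>R q + c *\<^sub>R r') = 2 * a * b * d + c\<^sup>2 * quad_form F r'" for a b c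
    using F(1,2) orth by (simp add: quad_form_comb3[OF sym(1)] d_def)
  note found = that
  \<comment> \<open>The condition on \<open>w\<close> guarantees that a zero of \<open>G\<close> on
    the path has a nonzero \<open>r'\<close>-coefficient; by \<open>indep\<close> the vector found
    is then nonzero.\<close>
  have main: thesis
    if u: "continuous_on {0..1} u" "continuous_on {0..1} v" "continuous_on {0..1} w"
      and F0: "\<And>t. 2 * u t * v t * d + (w t)\<^sup>2 * quad_form F r' = 0"
      and g0: "quad_form G (u 0 *\<^sub>R p + v 0 *\<^sub>R q + w 0 *\<^sub>R r') \<le> 0"
      and g1: "0 \<le> quad_form G (u 1 *\<^sub>R p + v 1 *\<^sub>R q + w 1 *\<^sub>R r')"
      and w: "\<And>t. w t = 0 \<Longrightarrow> 0 \<le> t \<Longrightarrow> t \<le> 1 \<Longrightarrow>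
               quad_form G (u t *\<^sub>R p + v t *\<^sub>R q + w t *\<^sub>R r') \<noteq> 0"
    for u v w :: "real \<Rightarrow> real"
  proof -
    have "\<exists>t\<ge>0. t \<le> 1 \<and> quad_form G (u t *\<^sub>R p + v t *\<^sub>R q + w t *\<^sub>R r') = 0"
      using u g0 g1 by (intro IVT') (auto intro!: continuous_intros)
    then obtain t where t: "0 \<le> t" "t \<le> 1" "quad_form G (u t *\<^sub>R p + v t *\<^sub>R q + w t *\<^sub>R r') = 0"
      by blast
    show thesis
    proof (rule found)
      show "u t *\<^sub>R p + v t *\<^sub>R q + w t *\<^sub>R r' \<in> N"
        using N r'_N by (intro subspace_add subspace_scale)
      show "u t *\<^sub>R p + v t *\<^sub>R q + w t *\<^sub>R r' \<noteq> 0"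
        using w t by (intro indep) blast
    qed (use t F0 F_comb in auto)
  qed
  \<comment> \<open>Chosen so that \<open>(1 - t)\<^sup>2 p + \<kappa> t\<^sup>2 q + (1 - t) t r'\<close> stays on the null cone of \<open>F\<close>; if \<open>\<kappa> = 0\<close>
    this path ends in 0, but then \<open>r'\<close> itself is on the cone and straight segments suffice.\<close>
  define \<kappa> where "\<kappa> = - quad_form F r' / (2 * d)"
  show thesis
  proof (cases "\<kappa> = 0")
    case False
    show thesis
    proof (rule main[of "\<lambda>t. (1 - t)\<^sup>2" "\<lambda>t. \<kappa> * t\<^sup>2" "\<lambda>t. (1 - t) * t"])
      show "2 * (1 - t)\<^sup>2 * (\<kappa> * t\<^sup>2) * d + ((1 - t) * t)\<^sup>2 * quad_form F r' = 0" for t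
        using d(1) by (simp add: \<kappa>_def power_mult_distrib)
    qed (use G False in \<open>auto intro!: continuous_intros simp: quad_form_scaleR\<close>)
  next
    case True
    then have 0: "quad_form F r' = 0" using d by (simp add: \<kappa>_def)
    show thesis
    proof (cases "0 \<le> quad_form G r'")
      case True
      show thesis
        by (rule main[of "\<lambda>t. 1 - t" "\<lambda>t. 0" "\<lambda>t. t"])
          (use G True 0 in \<open>auto intro!: continuous_intros\<close>)
    next
      case False
      show thesis
        by (rule main[of "\<lambda>t. 0" "\<lambda>t. t" "\<lambda>t. 1 - t"])
          (use G False 0 in \<open>auto intro!: continuous_intros\<close>)
    qed
  qed
qed

section \<open>The convexified joint range, separation and multipliers\<close>

text \<open>Equivalently, the triples of traces of \<open>B0 X\<close>, \<open>B1 X\<close>,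
  \<open>B2 X\<close> over positive semidefinite \<open>X\<close> of trace 1. Restricting to the
  unit sphere makes the hull compact.\<close>

definition joint_range_hull ::
  "real ^ 'n ^ 'n \<Rightarrow> real ^ 'n ^ 'n \<Rightarrow> real ^ 'n ^ 'n \<Rightarrow> (real \<times> real \<times> real) set" where
  "joint_range_hull B0 B1 B2 =
     convex hull ((\<lambda>x. (quad_form B0 x, quad_form B1 x, quad_form B2 x)) ` sphere 0 1)"

text \<open>Forms are homogeneous of degree two, so each convex weight \<open>u i\<close> can be
  absorbed into its vector as the factor \<open>sqrt (u i)\<close>. The indices are the generating
  triples themselves, hence the type of \<open>I\<close>.\<close>

lemma joint_range_hull_family:
  assumes "(a, b, c) \<in> joint_range_hull B0 B1 B2"
  obtains I :: "(real \<times> real \<times> real) set" and z where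
    "finite I" "(\<Sum>i\<in>I. z i \<bullet> z i) = 1" "(\<Sum>i\<in>I. quad_form B0 (z i)) = a"
    "(\<Sum>i\<in>I. quad_form B1 (z i)) = b" "(\<Sum>i\<in>I. quad_form B2 (z i)) = c"
proof -
  let ?f = "\<lambda>x. (quad_form B0 x, quad_form B1 x, quad_form B2 x)"
  obtain I u where I: "finite I" "I \<subseteq> ?f ` sphere 0 1" "\<And>i. i \<in> I \<Longrightarrow> 0 \<le> u i" "sum u I = 1"
    "(\<Sum>i\<in>I. u i *\<^sub>R i) = (a, b, c)"
    using assms unfolding joint_range_hull_def convex_hull_explicit by blast
  have "\<forall>i\<in>I. \<exists>x. norm x = 1 \<and> i = ?f x" using I(2) by (fastforce simp: image_iff)
  then obtain x where x: "\<And>i. i \<in> I \<Longrightarrow> norm (x i) = 1" "\<And>i. i \<in> I \<Longrightarrow> i = ?f (x i)"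
    by metis
  define z where "z i = sqrt (u i) *\<^sub>R x i" for i
  have form: "(\<Sum>i\<in>I. quad_form M (z i)) = (\<Sum>i\<in>I. u i * quad_form M (x i))" for M
    using I(3) by (intro sum.cong) (auto simp: z_def quad_form_scaleR)
  have "(\<Sum>i\<in>I. u i *\<^sub>R i) = (\<Sum>i\<in>I. u i *\<^sub>R ?f (x i))"
    using x(2) by (intro sum.cong) auto
  then have abc: "(\<Sum>i\<in>I. u i *\<^sub>R ?f (x i)) = (a, b, c)"
    using I(5) by simp
  show thesis
  proof
    have "(\<Sum>i\<in>I. z i \<bullet> z i) = sum u I"
      using I(3) x(1) by (intro sum.cong) (auto simp: z_def dot_square_norm simp flip: mult.assoc)
    then show "(\<Sum>i\<in>I. z i \<bullet> z i) = 1" using I(4) by simp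
    show "(\<Sum>i\<in>I. quad_form B0 (z i)) = a"
      using arg_cong[OF abc, of fst] by (simp add: form fst_sum)
    show "(\<Sum>i\<in>I. quad_form B1 (z i)) = b"
      using arg_cong[OF abc, of "fst \<circ> snd"] by (simp add: form fst_sum snd_sum)
    show "(\<Sum>i\<in>I. quad_form B2 (z i)) = c"
      using arg_cong[OF abc, of "snd \<circ> snd"] by (simp add: form snd_sum)
  qed (rule I(1))
qed

lemma compact_joint_range_hull: "compact (joint_range_hull B0 B1 B2)"
  unfolding joint_range_hull_def
  by (intro compact_convex_hull compact_continuous_image) (auto intro!: continuous_intros)

lemma convex_joint_range_hull: "convex (joint_range_hull B0 B1 B2)"
  unfolding joint_range_hull_def by simp

lemma joint_range_hull_nonempty: "joint_range_hull B0 B1 B2 \<noteq> {}"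
  unfolding joint_range_hull_def by simp

lemma pos_semidef_if_nonneg_on_sphere:
  assumes "symmetric_matrix M" "\<And>x. norm x = 1 \<Longrightarrow> 0 \<le> quad_form M x"
  shows "pos_semidef M"
  unfolding pos_semidef_def
proof (intro conjI allI)
  fix x
  show "0 \<le> quad_form M x"
  proof (cases "x = 0")
    case False
    have "quad_form M x = (norm x)\<^sup>2 * quad_form M (x /\<^sub>R norm x)"
      using False by (simp flip: quad_form_scaleR)
    then show ?thesis using assms(2)[of "x /\<^sub>R norm x"] False by simp
  qed simp
qed fact

lemma nonneg_slope_if_bounded_at_bot:
  fixes l :: real
  assumes "\<And>s. s < c \<Longrightarrow> l * s + k \<le> b"
  shows "0 \<le> l"
proof (rule ccontr)
  assume "\<not> 0 \<le> l"
  define s where "s = min (c - 1) ((b - k + 1) / l)"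
  have "b - k + 1 \<le> l * s"
    using \<open>\<not> 0 \<le> l\<close> mult_left_mono_neg[of s "(b - k + 1) / l" l] by (simp add: s_def)
  moreover have "l * s + k \<le> b" by (rule assms) (simp add: s_def)
  ultimately show False by simp
qed

text \<open>A hyperplane separates \<open>C\<close> from the open octant with apex
  \<open>(c, 0, 0)\<close>. The octant is unbounded below in each coordinate, so the normal is
  nonnegative, and the bound extends to the apex by approximation. The apex 0 serves the
  alternative, the apex at the minimum value serves the multipliers.\<close>

lemma octant_separation:
  fixes C :: "(real \<times> real \<times> real) set"
  assumes "convex C" "C \<noteq> {}" "\<And>x y z. (x, y, z) \<in> C \<Longrightarrow> \<not> (x < c \<and> y < 0 \<and> z < 0)"
  obtains l0 l1 l2 where "0 \<le> l0" "0 \<le> l1" "0 \<le> l2" "0 < l0 + l1 + l2"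
    "\<And>x y z. (x, y, z) \<in> C \<Longrightarrow> l0 * c \<le> l0 * x + l1 * y + l2 * z"
proof -
  let ?T = "{..<c} \<times> {..<0::real} \<times> {..<0::real}"
  have "(c - 1, - 1, - 1) \<in> ?T" by simp
  then have "?T \<noteq> {}" by blast
  moreover have "?T \<inter> C = {}" using assms(3) by auto
  moreover have "convex ?T" by (intro convex_Times convex_real_interval)
  ultimately obtain l b where l: "l \<noteq> 0" "\<forall>x\<in>?T. l \<bullet> x \<le> b" "\<forall>x\<in>C. b \<le> l \<bullet> x"
    using separating_hyperplane_sets[OF _ assms(1) _ assms(2)] by blast
  obtain l0 l1 l2 where l_eq: "l = (l0, l1, l2)" by (cases l) auto
  have T: "l0 * s + l1 * t + l2 * u \<le> b" if "s < c" "t < 0" "u < 0" for s t u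
    using bspec[OF l(2), of "(s, t, u)"] that by (simp add: l_eq)
  have "0 \<le> l0"
    using T[of _ "-1" "-1"] by (intro nonneg_slope_if_bounded_at_bot[of c l0 "- l1 - l2" b]) (simp add: algebra_simps)
  moreover have "0 \<le> l1"
    using T[of "c - 1" _ "-1"]
    by (intro nonneg_slope_if_bounded_at_bot[of 0 l1 "l0 * (c - 1) - l2" b]) (simp add: algebra_simps)
  moreover have "0 \<le> l2"
    using T[of "c - 1" "-1" _]
    by (intro nonneg_slope_if_bounded_at_bot[of 0 l2 "l0 * (c - 1) - l1" b]) (simp add: algebra_simps)
  moreover have "0 < l0 + l1 + l2"
    using l(1) calculation by (auto simp: l_eq zero_prod_def)
  moreover have "l0 * c \<le> b"
  proof (rule ccontr)
    assume "\<not> l0 * c \<le> b"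
    \<comment> \<open>Moving from the apex by \<open>- e\<close> in every coordinate gives the
      functional the value \<open>b + e\<close>, which exceeds \<open>b\<close>.\<close>
    define e where "e = (l0 * c - b) / (l0 + l1 + l2 + 1)"
    have "0 < e" using \<open>\<not> l0 * c \<le> b\<close> \<open>0 < l0 + l1 + l2\<close> by (simp add: e_def)
    moreover have "l0 * (c - e) + l1 * (- e) + l2 * (- e) \<le> b"
      using \<open>0 < e\<close> by (intro T) auto
    moreover have "e * (l0 + l1 + l2 + 1) = l0 * c - b"
      using \<open>0 < l0 + l1 + l2\<close> by (simp add: e_def)
    ultimately show False by (simp add: algebra_simps)
  qed
  moreover have "b \<le> l0 * x + l1 * y + l2 * z" if "(x, y, z) \<in> C" for x y z
    using bspec[OF l(3) that] by (simp add: l_eq)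
  ultimately show thesis using that by (meson order_trans)
qed

lemma quad_form_alternative:
  assumes sym: "symmetric_matrix B0" "symmetric_matrix B1" "symmetric_matrix B2"
  obtains (negative) a b c where "(a, b, c) \<in> joint_range_hull B0 B1 B2" "a < 0" "b < 0" "c < 0"
  | (semidefinite) a b c where "0 \<le> a" "0 \<le> b" "0 \<le> c" "a + b + c = 1"
      "pos_semidef (a *\<^sub>R B0 + b *\<^sub>R B1 + c *\<^sub>R B2)"
proof (cases "\<exists>a b c. (a, b, c) \<in> joint_range_hull B0 B1 B2 \<and> a < 0 \<and> b < 0 \<and> c < 0")
  case True
  then show thesis using negative by blast
next
  case False
  then obtain l0 l1 l2 where l: "0 \<le> l0" "0 \<le> l1" "0 \<le> l2" "0 < l0 + l1 + l2"
    "\<And>x y z. (x, y, z) \<in> joint_range_hull B0 B1 B2 \<Longrightarrow> l0 * 0 \<le> l0 * x + l1 * y + l2 * z"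
    using octant_separation[OF convex_joint_range_hull joint_range_hull_nonempty, of B0 B1 B2 0]
    by metis
  define L where "L = l0 + l1 + l2"
  have "pos_semidef ((l0 / L) *\<^sub>R B0 + (l1 / L) *\<^sub>R B1 + (l2 / L) *\<^sub>R B2)"
  proof (rule pos_semidef_if_nonneg_on_sphere)
    fix x :: "real ^ 'a" assume "norm x = 1"
    then have "(quad_form B0 x, quad_form B1 x, quad_form B2 x) \<in> joint_range_hull B0 B1 B2"
      unfolding joint_range_hull_def by (intro hull_inc) auto
    then have "0 \<le> l0 * quad_form B0 x + l1 * quad_form B1 x + l2 * quad_form B2 x"
      using l(5) by fastforce
    then have "0 \<le> (l0 * quad_form B0 x + l1 * quad_form B1 x + l2 * quad_form B2 x) / L"
      using l(4) by (simp add: L_def)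
    then show "0 \<le> quad_form ((l0 / L) *\<^sub>R B0 + (l1 / L) *\<^sub>R B1 + (l2 / L) *\<^sub>R B2) x"
      by (simp add: quad_form_matrix_simps add_divide_distrib)
  qed (intro symmetric_matrix_intros sym)
  moreover have "l0 / L + l1 / L + l2 / L = 1"
    using l(4) by (simp add: L_def flip: add_divide_distrib)
  ultimately show thesis using l by (intro semidefinite) (auto simp: L_def)
qed

text \<open>Let \<open>m = - \<mu>3\<close> be the least first coordinate on the part of the hull
  where the other two are nonpositive. Separating at the apex \<open>(m, 0, 0)\<close> and dividing
  by \<open>l0\<close> gives the multipliers. The term \<open>\<mu>3 *\<^sub>R mat 1\<close>
  homogenises the bound \<open>m\<close>, which holds on the unit sphere.\<close>

lemma lagrange_multipliers:
  assumes sym: "symmetric_matrix B0" "symmetric_matrix B1" "symmetric_matrix B2"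
    and slater: "(a, b, c) \<in> joint_range_hull B0 B1 B2" "a < 0" "b < 0" "c < 0"
  obtains \<mu>1 \<mu>2 \<mu>3 c1 c2 where "0 \<le> \<mu>1" "0 \<le> \<mu>2" "0 < \<mu>3"
    "(- \<mu>3, c1, c2) \<in> joint_range_hull B0 B1 B2" "c1 \<le> 0" "c2 \<le> 0" "\<mu>1 * c1 = 0" "\<mu>2 * c2 = 0"
    "pos_semidef (B0 + \<mu>1 *\<^sub>R B1 + \<mu>2 *\<^sub>R B2 + \<mu>3 *\<^sub>R mat 1)"
proof -
  let ?C = "joint_range_hull B0 B1 B2"
  let ?K = "?C \<inter> (UNIV \<times> {..0} \<times> {..0})"
  have "compact ?K"
    by (intro compact_Int_closed compact_joint_range_hull closed_Times) auto
  moreover have "(a, b, c) \<in> ?K" using slater by auto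
  ultimately obtain k where k: "k \<in> ?K" "\<And>y. y \<in> ?K \<Longrightarrow> fst k \<le> fst y"
    using continuous_attains_inf[of ?K fst] continuous_on_fst[OF continuous_on_id] by blast
  obtain m c1 c2 where k_eq: "k = (m, c1, c2)" by (cases k) auto
  have m: "(m, c1, c2) \<in> ?C" "c1 \<le> 0" "c2 \<le> 0" using k(1) by (auto simp: k_eq)
  have "m < 0" using k(2)[OF \<open>(a, b, c) \<in> ?K\<close>] slater(2) by (simp add: k_eq)
  have "\<not> (x < m \<and> y < 0 \<and> z < 0)" if "(x, y, z) \<in> ?C" for x y z
    using k(2)[of "(x, y, z)"] that by (auto simp: k_eq)
  then obtain l0 l1 l2 where l: "0 \<le> l0" "0 \<le> l1" "0 \<le> l2" "0 < l0 + l1 + l2"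
    "\<And>x y z. (x, y, z) \<in> ?C \<Longrightarrow> l0 * m \<le> l0 * x + l1 * y + l2 * z"
    using octant_separation[OF convex_joint_range_hull joint_range_hull_nonempty, of B0 B1 B2 m]
    by metis
  \<comment> \<open>The Slater point: with \<open>l0 = 0\<close>, its negative coordinates
    \<open>b\<close> and \<open>c\<close> would force \<open>l1\<close> and \<open>l2\<close> to
    vanish as well.\<close>
  have "l0 \<noteq> 0"
  proof
    assume "l0 = 0"
    then have "0 \<le> l1 * b + l2 * c" using l(5)[OF slater(1)] by simp
    moreover have "l1 * b \<le> 0" "l2 * c \<le> 0"
      using l slater by (auto intro: mult_nonneg_nonpos)
    ultimately have "l1 * b = 0" "l2 * c = 0" by linarith+
    then show False using slater l(4) \<open>l0 = 0\<close> by simp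
  qed
  then have "0 < l0" using l(1) by simp
  have "l1 * c1 \<le> 0" "l2 * c2 \<le> 0"
    using l m by (auto intro: mult_nonneg_nonpos)
  \<comment> \<open>Complementary slackness comes from evaluating the separation inequality at the
    minimiser itself.\<close>
  moreover have "0 \<le> l1 * c1 + l2 * c2" using l(5)[OF m(1)] by simp
  ultimately have compl: "l1 * c1 = 0" "l2 * c2 = 0" by linarith+
  have "pos_semidef (B0 + (l1 / l0) *\<^sub>R B1 + (l2 / l0) *\<^sub>R B2 + (- m) *\<^sub>R mat 1)"
  proof (rule pos_semidef_if_nonneg_on_sphere)
    fix x :: "real ^ 'a" assume x: "norm x = 1"
    then have "(quad_form B0 x, quad_form B1 x, quad_form B2 x) \<in> ?C"
      unfolding joint_range_hull_def by (intro hull_inc) auto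
    then have "l0 * m \<le> l0 * quad_form B0 x + l1 * quad_form B1 x + l2 * quad_form B2 x"
      by (rule l(5))
    then have "m \<le> quad_form B0 x + l1 / l0 * quad_form B1 x + l2 / l0 * quad_form B2 x"
      using \<open>0 < l0\<close> by (simp add: field_simps)
    then show "0 \<le> quad_form (B0 + (l1 / l0) *\<^sub>R B1 + (l2 / l0) *\<^sub>R B2 + (- m) *\<^sub>R mat 1) x"
      unfolding quad_form_matrix_simps using x by (simp add: dot_square_norm)
  qed (intro symmetric_matrix_intros sym)
  then show thesis
    using that[of "l1 / l0" "l2 / l0" "- m" c1 c2] l m compl \<open>0 < l0\<close> \<open>m < 0\<close> by simp
qed

section \<open>Property IR from the failure of (ii)\<close>

text \<open>The two strict inequalities survive any small move, so only \<open>B2\<close> has to be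
  pushed below 0, which needs some direction where it is negative.\<close>

lemma exists_all_negative_perturbation:
  assumes sym: "symmetric_matrix B2"
    and x: "quad_form B0 x < 0" "quad_form B1 x < 0" "quad_form B2 x = 0"
    and y: "quad_form B2 y < 0"
  obtains x' where "quad_form B0 x' < 0" "quad_form B1 x' < 0" "quad_form B2 x' < 0"
proof -
  \<comment> \<open>With this choice of sign, moving along \<open>d\<close> decreases \<open>B2\<close> at second order at the latest.\<close>
  obtain d where d: "quad_form B2 d < 0" "x \<bullet> (B2 *v d) \<le> 0"
  proof (cases "x \<bullet> (B2 *v y) \<le> 0")
    case True
    then show thesis using that y by blast
  next
    case False
    have "B2 *v (- y) = - (B2 *v y)"
      using matrix_vector_mult_scaleR[of B2 "-1" y] by simp
    then show thesis using that[of "- y"] y False by simp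
  qed
  have ev: "\<forall>\<^sub>F e in at_right 0. quad_form M (x + e *\<^sub>R d) < 0" if "quad_form M x < 0" for M
  proof -
    have "continuous_on UNIV (\<lambda>e. quad_form M (x + e *\<^sub>R d))"
      by (intro continuous_intros)
    then have "((\<lambda>e. quad_form M (x + e *\<^sub>R d)) \<longlongrightarrow> quad_form M (x + 0 *\<^sub>R d)) (at_right 0)"
      by (meson UNIV_I continuous_on_def tendsto_within_subset subset_UNIV)
    then show ?thesis using that by (intro order_tendstoD(2)) auto
  qed
  have "\<forall>\<^sub>F e in at_right (0::real). 0 < e" by (simp add: eventually_at_right_less)
  then have "\<forall>\<^sub>F e in at_right 0. quad_form B0 (x + e *\<^sub>R d) < 0 \<and> quad_form B1 (x + e *\<^sub>R d) < 0 \<and> 0 < e"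
    using ev[OF x(1)] ev[OF x(2)] by eventually_elim auto
  then obtain e where e: "quad_form B0 (x + e *\<^sub>R d) < 0" "quad_form B1 (x + e *\<^sub>R d) < 0" "0 < e"
    using eventually_happens[of _ "at_right (0::real)"] by auto
  have "quad_form B2 (x + e *\<^sub>R d) = e\<^sup>2 * quad_form B2 d + 2 * e * (x \<bullet> (B2 *v d))"
    using quad_form_comb2[OF sym, of 1 x e d] x(3) by simp
  also have "\<dots> < 0"
    using d e by (intro add_neg_nonpos mult_pos_neg mult_nonneg_nonpos) auto
  finally show thesis using that e by blast
qed

lemma property_IR_if_not_pos_semidef:
  assumes sym: "symmetric_matrix B0" "symmetric_matrix B1" "symmetric_matrix B2"
    and not_neg: "\<And>x. \<not> (quad_form B0 x < 0 \<and> quad_form B1 x < 0 \<and> quad_form B2 x < 0)"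
    and no_sol: "\<And>x. \<not> (quad_form B0 x < 0 \<and> quad_form B1 x = 0 \<and> quad_form B2 x = 0)"
    and not_psd: "\<And>a b c. 0 \<le> a \<Longrightarrow> 0 \<le> b \<Longrightarrow> 0 \<le> c \<Longrightarrow> a + b + c = 1 \<Longrightarrow>
                    \<not> pos_semidef (a *\<^sub>R B0 + b *\<^sub>R B1 + c *\<^sub>R B2)"
  shows "property_IR B0 B1 B2"
proof -
  obtain a b c where slater: "(a, b, c) \<in> joint_range_hull B0 B1 B2" "a < 0" "b < 0" "c < 0"
    using quad_form_alternative[OF sym] not_psd by metis
  \<comment> \<open>A negative sum has a negative summand; these vectors supply the directions for
    the perturbations below.\<close>
  have neg: "(\<exists>y. quad_form B1 y < 0) \<and> (\<exists>y. quad_form B2 y < 0)"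
  proof -
    obtain I :: "(real \<times> real \<times> real) set" and z where
      "(\<Sum>i\<in>I. quad_form B1 (z i)) = b" "(\<Sum>i\<in>I. quad_form B2 (z i)) = c"
      using joint_range_hull_family[OF slater(1)] by metis
    then show ?thesis using slater(3,4) by (metis not_le sum_nonneg)
  qed
  have no_weak: False if x: "quad_form B0 x < 0" "quad_form B1 x \<le> 0" "quad_form B2 x \<le> 0" for x
  proof -
    consider "quad_form B1 x < 0" "quad_form B2 x < 0" | "quad_form B1 x = 0" "quad_form B2 x = 0"
      | "quad_form B1 x < 0" "quad_form B2 x = 0" | "quad_form B1 x = 0" "quad_form B2 x < 0"
      using x by linarith
    then show False
    proof cases
      case 3
      then show False
        using exists_all_negative_perturbation[OF sym(3) x(1)] neg not_neg by metis
    next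
      case 4
      then show False
        using exists_all_negative_perturbation[OF sym(2) x(1)] neg not_neg by metis
    qed (use x not_neg no_sol in blast)+
  qed
  obtain \<mu>1 \<mu>2 \<mu>3 c1 c2 where \<mu>: "0 \<le> \<mu>1" "0 \<le> \<mu>2" "0 < \<mu>3"
    and hull: "(- \<mu>3, c1, c2) \<in> joint_range_hull B0 B1 B2"
    and c: "c1 \<le> 0" "c2 \<le> 0" "\<mu>1 * c1 = 0" "\<mu>2 * c2 = 0"
    and psd: "pos_semidef (B0 + \<mu>1 *\<^sub>R B1 + \<mu>2 *\<^sub>R B2 + \<mu>3 *\<^sub>R mat 1)"
    using lagrange_multipliers[OF sym slater] .
  define Z where "Z = B0 + \<mu>1 *\<^sub>R B1 + \<mu>2 *\<^sub>R B2 + \<mu>3 *\<^sub>R mat 1"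
  have Z: "quad_form Z x = quad_form B0 x + \<mu>1 * quad_form B1 x + \<mu>2 * quad_form B2 x + \<mu>3 * (x \<bullet> x)" for x
    by (simp add: Z_def quad_form_matrix_simps)
  have Z_nonneg: "0 \<le> quad_form Z x" for x
    using psd by (simp add: Z_def pos_semidef_def)
  \<comment> \<open>The hypotheses speak of products so as to cover both a vanishing multiplier and
    a vanishing form.\<close>
  have N: "quad_form B0 x < 0"
    if "x \<in> null_space Z" "x \<noteq> 0" "\<mu>1 * quad_form B1 x = 0" "\<mu>2 * quad_form B2 x = 0" for x
  proof -
    have "quad_form B0 x = - (\<mu>3 * (x \<bullet> x))"
      using Z[of x] quad_form_null_space[OF that(1)] that(3,4) by simp
    then show ?thesis using \<mu>(3) that(2) by simp
  qed
  obtain I :: "(real \<times> real \<times> real) set" and z where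
    z: "finite I" "(\<Sum>i\<in>I. z i \<bullet> z i) = 1" "(\<Sum>i\<in>I. quad_form B0 (z i)) = - \<mu>3"
    "(\<Sum>i\<in>I. quad_form B1 (z i)) = c1" "(\<Sum>i\<in>I. quad_form B2 (z i)) = c2"
    using joint_range_hull_family[OF hull] .
  \<comment> \<open>By complementary slackness the sum is \<open>- \<mu>3 + 0 + 0 + \<mu>3\<close>;
    its terms are nonnegative, so each vanishes.\<close>
  have "(\<Sum>i\<in>I. quad_form Z (z i)) = 0"
    unfolding Z sum.distrib sum_distrib_left[symmetric] z using c(3,4) by linarith
  then have "quad_form Z (z i) = 0" if "i \<in> I" for i
    using that z(1) Z_nonneg by (simp add: sum_nonneg_eq_0_iff)
  then have z_N: "z i \<in> null_space Z" if "i \<in> I" for i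
    using that psd unfolding Z_def by (intro pos_semidef_null_space) auto
  have iso: "\<exists>x\<in>null_space Z. x \<noteq> 0 \<and> quad_form F x = 0 \<and> quad_form G x \<le> 0"
    if "symmetric_matrix F" "symmetric_matrix G"
      "(\<Sum>i\<in>I. quad_form F (z i)) = 0" "(\<Sum>i\<in>I. quad_form G (z i)) \<le> 0" for F G
    by (rule exists_isotropic_nonpos[OF z(1) subspace_null_space[of Z] that(1,2) z_N _ that(3,4)])
      (use z(2) in auto)
  \<comment> \<open>The shift makes both sums vanish, so that the cases \<open>c1 < 0\<close> and \<open>c2 < 0\<close> need no separate treatment.\<close>
  define F where "F = B1 + (- c1) *\<^sub>R mat 1"
  define G where "G = B2 + (- c2) *\<^sub>R mat 1"
  have FG: "symmetric_matrix F" "symmetric_matrix G"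
    unfolding F_def G_def by (intro symmetric_matrix_intros sym)+
  have FG_form: "quad_form F x = quad_form B1 x - c1 * (x \<bullet> x)"
    "quad_form G x = quad_form B2 x - c2 * (x \<bullet> x)" for x
    unfolding F_def G_def quad_form_matrix_simps by auto
  have FG_sum: "(\<Sum>i\<in>I. quad_form F (z i)) = 0" "(\<Sum>i\<in>I. quad_form G (z i)) = 0"
    unfolding FG_form sum_subtractf sum_distrib_left[symmetric] z by auto
  have nonpos: "c1 * (x \<bullet> x) \<le> 0" "c2 * (x \<bullet> x) \<le> 0" for x :: "real ^ 'a"
    using c by (auto intro: mult_nonpos_nonneg)
  \<comment> \<open>If \<open>\<mu>1 = 0\<close>, a zero of \<open>G\<close> with \<open>F\<close>
    nonpositive has \<open>B2\<close> equal to \<open>c2 * (x \<bullet> x)\<close> and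
    \<open>B1\<close> nonpositive. Slackness makes \<open>\<mu>2 * quad_form B2 x\<close> vanish, so
    \<open>N\<close> makes \<open>B0\<close> negative there, against \<open>no_weak\<close>. The
    case of \<open>\<mu>2\<close> is symmetric.\<close>
  have "\<mu>1 \<noteq> 0"
  proof
    assume "\<mu>1 = 0"
    obtain x where "x \<in> null_space Z" "x \<noteq> 0" "quad_form G x = 0" "quad_form F x \<le> 0"
      using iso[OF FG(2,1)] FG_sum by auto
    then show False
      using no_weak[of x] N[of x] \<open>\<mu>1 = 0\<close> nonpos[of x] c(4) by (simp add: FG_form)
  qed
  have "\<mu>2 \<noteq> 0"
  proof
    assume "\<mu>2 = 0"
    obtain x where "x \<in> null_space Z" "x \<noteq> 0" "quad_form F x = 0" "quad_form G x \<le> 0"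
      using iso[OF FG] FG_sum by auto
    then show False
      using no_weak[of x] N[of x] \<open>\<mu>2 = 0\<close> nonpos[of x] c(3) by (simp add: FG_form)
  qed
  have c0: "c1 = 0" "c2 = 0" using c \<open>\<mu>1 \<noteq> 0\<close> \<open>\<mu>2 \<noteq> 0\<close> by auto
  have no_common_zero: False
    if "x \<in> null_space Z" "x \<noteq> 0" "quad_form B1 x = 0" "quad_form B2 x = 0" for x
    using that N[of x] no_sol by simp
  obtain p where p: "p \<in> null_space Z" "quad_form B1 p = 0" "quad_form B2 p < 0"
  proof -
    obtain x where "x \<in> null_space Z" "x \<noteq> 0" "quad_form B1 x = 0" "quad_form B2 x \<le> 0"
      using iso[OF sym(2,3)] z(4,5) c0 by auto
    then show thesis using that no_common_zero by fastforce
  qed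
  \<comment> \<open>Since the sum of \<open>B2\<close> over the family is exactly 0, the argument
    for \<open>p\<close> applies to \<open>- B2\<close> as well.\<close>
  obtain q where q: "q \<in> null_space Z" "quad_form B1 q = 0" "0 < quad_form B2 q"
  proof -
    have "(\<Sum>i\<in>I. quad_form ((- 1) *\<^sub>R B2) (z i)) = 0"
      unfolding quad_form_matrix_scaleR sum_distrib_left[symmetric] z(5) c0 by simp
    then obtain x where "x \<in> null_space Z" "x \<noteq> 0" "quad_form B1 x = 0" "quad_form ((- 1) *\<^sub>R B2) x \<le> 0"
      using iso[OF sym(2) symmetric_matrix_scaleR[OF sym(3), of "-1"]] z(4) c0 by auto
    moreover have "quad_form ((- 1) *\<^sub>R B2) x = - quad_form B2 x"
      by (simp only: quad_form_matrix_scaleR)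
    ultimately show thesis using that no_common_zero by fastforce
  qed
  \<comment> \<open>Otherwise \<open>B1\<close> vanishes on the whole span of \<open>p\<close> and
    \<open>q\<close>, and a zero of \<open>B2\<close> on the arc from \<open>q\<close> to
    \<open>p\<close> would be a common zero. That point cannot be 0 either, because
    \<open>B2\<close> has opposite signs at \<open>p\<close> and \<open>q\<close>.\<close>
  have cross: "p \<bullet> (B1 *v q) \<noteq> 0"
  proof
    assume "p \<bullet> (B1 *v q) = 0"
    obtain c s :: real where cs: "c\<^sup>2 + s\<^sup>2 = 1" "quad_form B2 (c *\<^sub>R q + s *\<^sub>R p) = 0"
      using exists_isotropic_rotation[OF sym(3) q(3) p(3)] .
    have "c *\<^sub>R q + s *\<^sub>R p \<in> null_space Z"
      using p(1) q(1) by (intro subspace_add subspace_scale subspace_null_space)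
    moreover have "quad_form B1 (c *\<^sub>R q + s *\<^sub>R p) = 0"
      using p(2) q(2) \<open>p \<bullet> (B1 *v q) = 0\<close> symmetric_matrix_dot[OF sym(2), of p q]
      by (simp add: quad_form_comb2[OF sym(2)])
    ultimately have "c *\<^sub>R q + s *\<^sub>R p = 0" using no_common_zero cs(2) by blast
    then have "c\<^sup>2 * quad_form B2 q = s\<^sup>2 * quad_form B2 p"
      by (metis add_eq_0_iff quad_form_minus quad_form_scaleR)
    moreover have "0 \<le> c\<^sup>2 * quad_form B2 q" "s\<^sup>2 * quad_form B2 p \<le> 0"
      using p(3) q(3) by (auto intro: mult_nonneg_nonpos)
    ultimately have "c\<^sup>2 * quad_form B2 q = 0" "s\<^sup>2 * quad_form B2 p = 0" by auto
    then show False using p(3) q(3) cs(1) by simp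
  qed
  have "null_space Z = span {p, q}"
  proof
    show "span {p, q} \<subseteq> null_space Z"
      using p(1) q(1) by (intro span_minimal subspace_null_space) auto
    show "null_space Z \<subseteq> span {p, q}"
    proof
      fix r assume "r \<in> null_space Z"
      then show "r \<in> span {p, q}"
        using exists_common_zero_dim3[OF sym(2,3) subspace_null_space p(1) q(1) _ p(2) q(2) cross p(3) q(3)]
          no_common_zero by metis
    qed
  qed
  moreover have "0 < \<mu>1" "0 < \<mu>2" using \<mu> \<open>\<mu>1 \<noteq> 0\<close> \<open>\<mu>2 \<noteq> 0\<close> by auto
  ultimately show ?thesis
    unfolding property_IR_def Let_def using psd \<mu>(3) p(2,3) q(2,3) cross
    unfolding Z_def by metis
qed

section \<open>The converse and the equivalence\<close>

text \<open>At \<open>p\<close> and \<open>q\<close> the form \<open>B1\<close> vanishes and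
  \<open>Z\<close> gives \<open>B0 = - \<mu>2 B2 - \<mu>3 |x|^2\<close>. Substituting this into the
  semidefinite combination makes \<open>(c - a * \<mu>2) * quad_form B2 x\<close> positive at both,
  although \<open>B2\<close> has opposite signs there.\<close>

lemma pos_semidef_imp_not_property_IR:
  assumes psd: "pos_semidef (a *\<^sub>R B0 + b *\<^sub>R B1 + c *\<^sub>R B2)" and a: "0 < a"
  shows "\<not> property_IR B0 B1 B2"
proof
  assume "property_IR B0 B1 B2"
  then obtain \<mu>1 \<mu>2 \<mu>3 :: real and p q where \<mu>: "0 < \<mu>3"
    and null: "null_space (B0 + \<mu>1 *\<^sub>R B1 + \<mu>2 *\<^sub>R B2 + \<mu>3 *\<^sub>R mat 1) = span {p, q}"
    and B1: "quad_form B1 p = 0" "quad_form B1 q = 0"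
    and B2: "quad_form B2 p < 0" "0 < quad_form B2 q"
    unfolding property_IR_def Let_def by blast
  have *: "0 < (c - a * \<mu>2) * quad_form B2 x"
    if x: "x \<in> {p, q}" and "x \<noteq> 0" for x
  proof -
    have "quad_form B1 x = 0" using x B1 by auto
    moreover have "x \<in> span {p, q}" using x by (rule span_base)
    then have "quad_form B0 x + \<mu>1 * quad_form B1 x + \<mu>2 * quad_form B2 x + \<mu>3 * (x \<bullet> x) = 0"
      unfolding null[symmetric] by (auto dest!: quad_form_null_space simp: quad_form_matrix_simps)
    ultimately have "quad_form B0 x = - (\<mu>2 * quad_form B2 x) - \<mu>3 * (x \<bullet> x)" by simp
    then have "(c - a * \<mu>2) * quad_form B2 x
        = a * quad_form B0 x + c * quad_form B2 x + a * (\<mu>3 * (x \<bullet> x))"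
      by (simp only:) (simp add: algebra_simps)
    moreover have "0 \<le> a * quad_form B0 x + c * quad_form B2 x"
      using psd \<open>quad_form B1 x = 0\<close> unfolding pos_semidef_def quad_form_matrix_simps
      by (metis add.right_neutral mult_zero_right)
    moreover have "0 < a * (\<mu>3 * (x \<bullet> x))" using a \<mu> \<open>x \<noteq> 0\<close> by simp
    ultimately show ?thesis by linarith
  qed
  have "p \<noteq> 0" "q \<noteq> 0" using B2 by auto
  then show False using *[of p] *[of q] B2 by (auto simp: zero_less_mult_iff)
qed

theorem theorem4p3:
  fixes A :: "nat \<Rightarrow> real ^ 'n ^ 'n"
  assumes "\<And>k. k \<in> {0, 1, 2} \<Longrightarrow> symmetric_matrix (A k)"
  shows "((\<forall>x. 0 \<le> Max {quad_form (A 0) x, quad_form (A 1) x, quad_form (A 2) x}) \<and>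
          (\<exists>j. j permutes {0, 1, 2} \<and>
               \<not> (\<exists>x. quad_form (A (j 0)) x < 0 \<and>
                      quad_form (A (j 1)) x = 0 \<and>
                      quad_form (A (j 2)) x = 0) \<and>
               \<not> property_IR (A (j 0)) (A (j 1)) (A (j 2))))
         \<longleftrightarrow>
         (\<exists>\<mu> :: nat \<Rightarrow> real.
            (\<forall>k \<in> {0, 1, 2}. 0 \<le> \<mu> k) \<and> (\<Sum>k \<in> {0, 1, 2}. \<mu> k) = 1 \<and>
            pos_semidef (\<mu> 0 *\<^sub>R A 0 + \<mu> 1 *\<^sub>R A 1 + \<mu> 2 *\<^sub>R A 2))"
  (is "?i \<longleftrightarrow> ?ii")
proof
  assume ?i
  then obtain j where max: "\<And>x. 0 \<le> Max {quad_form (A 0) x, quad_form (A 1) x, quad_form (A 2) x}"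
    and j: "j permutes {0, 1, 2}"
    and no_sol: "\<And>x. \<not> (quad_form (A (j 0)) x < 0 \<and> quad_form (A (j 1)) x = 0 \<and> quad_form (A (j 2)) x = 0)"
    and not_IR: "\<not> property_IR (A (j 0)) (A (j 1)) (A (j 2))"
    by blast
  have image: "j ` {0, 1, 2} = {0, 1, 2}" by (rule permutes_image[OF j])
  have distinct: "j 0 \<noteq> j 1" "j 0 \<noteq> j 2" "j 1 \<noteq> j 2"
    by (simp_all add: inj_eq[OF permutes_inj[OF j]])
  have "\<not> (quad_form (A (j 0)) x < 0 \<and> quad_form (A (j 1)) x < 0 \<and> quad_form (A (j 2)) x < 0)" for x
  proof -
    have "\<exists>k\<in>{0, 1, 2}. 0 \<le> quad_form (A k) x"
      using max[of x] by (auto simp: Max_ge_iff)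
    then have "\<exists>k\<in>{0, 1, 2}. 0 \<le> quad_form (A (j k)) x"
      using image by (metis (no_types, lifting) imageE)
    then show ?thesis by auto
  qed
  moreover have "symmetric_matrix (A (j k))" if "k \<in> {0, 1, 2}" for k
    using assms image that by blast
  ultimately obtain a b c where abc: "0 \<le> a" "0 \<le> b" "0 \<le> c" "a + b + c = 1"
    and psd: "pos_semidef (a *\<^sub>R A (j 0) + b *\<^sub>R A (j 1) + c *\<^sub>R A (j 2))"
    using property_IR_if_not_pos_semidef[of "A (j 0)" "A (j 1)" "A (j 2)"] no_sol not_IR
    by (metis insert_iff)
  define \<mu> where "\<mu> k = (if k = j 0 then a else if k = j 1 then b else c)" for k
  \<comment> \<open>Kept polymorphic, because it is applied both to the sum of the weights and to
    the sum of the matrices.\<close>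
  have reindex: "(\<Sum>k\<in>{0, 1, 2}. f k) = f (j 0) + f (j 1) + f (j 2)" for f :: "nat \<Rightarrow> 'b::comm_monoid_add"
    using sum.permute[OF j, of f] by (simp add: add.assoc)
  have \<mu>_j: "\<mu> (j 0) = a" "\<mu> (j 1) = b" "\<mu> (j 2) = c"
    using distinct by (auto simp: \<mu>_def)
  have "\<forall>k\<in>{0, 1, 2}. 0 \<le> \<mu> k" using abc by (auto simp: \<mu>_def)
  moreover have "(\<Sum>k\<in>{0, 1, 2}. \<mu> k) = 1"
    unfolding reindex \<mu>_j by (rule abc(4))
  moreover have "\<mu> 0 *\<^sub>R A 0 + \<mu> 1 *\<^sub>R A 1 + \<mu> 2 *\<^sub>R A 2 = (\<Sum>k\<in>{0, 1, 2}. \<mu> k *\<^sub>R A k)"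
    by (simp add: add.assoc)
  then have "pos_semidef (\<mu> 0 *\<^sub>R A 0 + \<mu> 1 *\<^sub>R A 1 + \<mu> 2 *\<^sub>R A 2)"
    using psd unfolding reindex \<mu>_j by simp
  ultimately show ?ii by blast
next
  assume ?ii
  then obtain \<mu> :: "nat \<Rightarrow> real" where \<mu>: "0 \<le> \<mu> 0" "0 \<le> \<mu> 1" "0 \<le> \<mu> 2" "\<mu> 0 + \<mu> 1 + \<mu> 2 = 1"
    and psd: "pos_semidef (\<mu> 0 *\<^sub>R A 0 + \<mu> 1 *\<^sub>R A 1 + \<mu> 2 *\<^sub>R A 2)"
    by (auto simp: add.assoc)
  have nonneg: "0 \<le> \<mu> 0 * quad_form (A 0) x + \<mu> 1 * quad_form (A 1) x + \<mu> 2 * quad_form (A 2) x" for x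
    using psd by (simp add: pos_semidef_def quad_form_matrix_simps)
  have max: "0 \<le> Max {quad_form (A 0) x, quad_form (A 1) x, quad_form (A 2) x}" (is "0 \<le> ?m") for x
  proof -
    have "\<mu> 0 * quad_form (A 0) x + \<mu> 1 * quad_form (A 1) x + \<mu> 2 * quad_form (A 2) x
        \<le> \<mu> 0 * ?m + \<mu> 1 * ?m + \<mu> 2 * ?m"
      using \<mu> by (intro add_mono mult_left_mono) auto
    also have "\<dots> = ?m" using \<mu>(4) by (simp flip: distrib_right)
    finally show ?thesis using nonneg[of x] by linarith
  qed
  obtain k where k: "k \<in> {0, 1, 2}" "0 < \<mu> k"
    using \<mu> by (metis add.right_neutral insertCI less_eq_real_def zero_neq_one)
  \<comment> \<open>The transposition brings an index of positive weight to the front, where the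
    system asks for a negative value and where \<open>pos_semidef_imp_not_property_IR\<close> needs
    a positive coefficient.\<close>
  define j where "j = Transposition.transpose 0 k"
  have j: "j permutes {0, 1, 2}"
    unfolding j_def using k(1) by (intro permutes_swap_id) auto
  have comb: "\<mu> 0 *\<^sub>R A 0 + \<mu> 1 *\<^sub>R A 1 + \<mu> 2 *\<^sub>R A 2
    = \<mu> (j 0) *\<^sub>R A (j 0) + \<mu> (j 1) *\<^sub>R A (j 1) + \<mu> (j 2) *\<^sub>R A (j 2)"
    using k(1) by (auto simp: j_def Transposition.transpose_def)
  have "0 < \<mu> (j 0)" using k(2) by (simp add: j_def)
  have "\<not> (quad_form (A (j 0)) x < 0 \<and> quad_form (A (j 1)) x = 0 \<and> quad_form (A (j 2)) x = 0)" for x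
  proof -
    have "0 \<le> \<mu> (j 0) * quad_form (A (j 0)) x + \<mu> (j 1) * quad_form (A (j 1)) x
        + \<mu> (j 2) * quad_form (A (j 2)) x"
      using psd unfolding comb pos_semidef_def quad_form_matrix_simps by blast
    then show ?thesis using \<open>0 < \<mu> (j 0)\<close> by (auto simp: zero_le_mult_iff)
  qed
  moreover have "\<not> property_IR (A (j 0)) (A (j 1)) (A (j 2))"
    using pos_semidef_imp_not_property_IR[OF psd[unfolded comb] \<open>0 < \<mu> (j 0)\<close>] .
  ultimately show ?i using max j by blast
qed

end
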